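(* Let $A\in\mathbb{R}^{n\times n}$ be a symmetric matrix with distinct eigenvalues $\lambda_1,\dots,\lambda_m$, $m\ge 2$, and let $\eta=\min_{k\neq \ell}|\lambda_k-\lambda_\ell|$. Then there exists $\varepsilon>0$ (depending only on $A$) such that the following holds. Let $\tilde X\in\mathbb{R}^{n\times n}$ be nonsingular with $\mathcal{E}_0\neq\emptyset$, let $F^*$ be the associated matrix, $D^*$ the associated diagonal matrix and $\boldsymbol z^*=(F^*,D^* )$ (all defined in the context), and suppose $\|F^*\|_2<\varepsilon$. Let $0<\delta<\min\{\eta/3,\ \|F^*\|_2\}$. Then in the open ball of radius $\delta$ centered at $\boldsymbol z^*$ in $\mathbb{R}^{n^2+n}$, problem P' has exactly one solution, and this solution is the solution $\boldsymbol z^*$ of problem P.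
   Context: "Eigenvector matrix" of $A$ means an orthogonal matrix $X$ such that $X^\top A X$ is diagonal; $\mathcal{X}$ is the set of all eigenvector matrices of $A$. $\|\cdot\|_2$ is the spectral norm and $\|\cdot\|_F$ the Frobenius norm. Given a nonsingular $\tilde X\in\mathbb{R}^{n\times n}$, let $\mathcal{E}_0=\{E\in\mathbb{R}^{n\times n} : \tilde X(I_n+E)\in\mathcal{X},\ \|E\|_2<1/3\}$, assumed nonempty. For $E\in\mathcal{E}_0$ and $X=\tilde X(I_n+E)$, let $I_k$ be the set of indices of columns of $X$ that are eigenvectors belonging to $\lambda_k$ ($k=1,\dots,m$). It is known that $I_1,\dots,I_m$ do not depend on the choice of $E\in\mathcal{E}_0$. For an index $i\in\{1,\dots,n\}$, $\mathcal{K}(i)$ denotes the $k$ with $i\in I_k$. Let $\mathcal{E}$ be the set of all $E'\in\mathbb{R}^{n\times n}$ such that $X'=\tilde X(I_n+E')\in\mathcal{X}$ and the index sets of $X'$ (defined in the same way) are $I_1,\dots,I_m$. It is known that there is a unique matrix $F^*\in\mathbb{R}^{n\times n}$ such that (i) $F^*\in\mathcal{E}$; (ii) $\|F^*\|_2<3\min_{E\in\mathcal{E}_0}\|E\|_2<1$; (iii) for each $k$, the principal submatrix of $F^*$ with rows and columns indexed by $I_k$ is symmetric. $F^*$ denotes this matrix, $X^*=\tilde X(I_n+F^* )$, and $D^*=(X^* )^\top A X^*$ (a diagonal matrix). Put $R=(r_{ij})=I_n-\tilde X^\top\tilde X$ and $S=(s_{ij})=\tilde X^\top A\tilde X$. For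 $F\in\mathbb{R}^{n\times n}$ with $\|F\|_2<1$ and diagonal $D\in\mathbb{R}^{n\times n}$ define $$\Delta(F)=(I_n+F)^{-1}-I_n+F=\sum_{k\ge 2}(-F)^k,$$ $$\Delta_1(F)=\Delta(F)+\Delta(F)^\top+(F-\Delta(F))^\top(F-\Delta(F)),$$ $$\Delta_2(F,D)=-D\Delta(F)-(D\Delta(F))^\top-(F-\Delta(F))^\top D(F-\Delta(F)).$$ For unknowns $F=(f_{ij})\in\mathbb{R}^{n\times n}$ with $\|F\|_2<1$ and $D=\mathrm{diag}(d_1,\dots,d_n)$ consider the equations (a) $f_{ij}+f_{ji}=r_{ij}+(\Delta_1(F))_{ij}$ for all $i,j$; (b) $d_i\delta_{ij}-d_if_{ij}-d_jf_{ji}=s_{ij}+(\Delta_2(F,D))_{ij}$; (c) $f_{ij}=f_{ji}$ for all $i,j$ with $\mathcal{K}(i)=\mathcal{K}(j)$. Here $\delta_{ij}$ is the Kronecker delta. Problem P: solve (a), (c), and (b) for all $i,j=1,\dots,n$. Problem P': solve (a), (c), and (b) only for those $(i,j)$ with $\mathcal{K}(i)\neq\mathcal{K}(j)$ or $i=j$. A pair $(F,D)$ with $D$ diagonal is identified with a vector $\boldsymbol z\in\mathbb{R}^{n^2+n}$ (the entries $f_{ij}$ and $d_i$), with Euclidean norm $\|\boldsymbol z\|=\sqrt{\|F\|_F^2+\|D\|_F^2}$. The vector $\boldsymbol z^*$ corresponds to $(F^*,D^* )$; it is a solution of problem P. *)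

theory Defs
  imports "HOL-Analysis.Analysis"
begin

definition spectral_norm :: "real^'n^'n \<Rightarrow> real" where
  "spectral_norm M = onorm (\<lambda>x. M *v x)"

definition is_diagonal :: "real^'n^'n \<Rightarrow> bool" where
  "is_diagonal M \<longleftrightarrow> (\<forall>i j. i \<noteq> j \<longrightarrow> M $ i $ j = 0)"

definition diag_mat :: "real^'n \<Rightarrow> real^'n^'n" where
  "diag_mat d = (\<chi> i j. if i = j then d $ i else 0)"

definition diag_vec :: "real^'n^'n \<Rightarrow> real^'n" where
  "diag_vec D = (\<chi> i. D $ i $ i)"

definition eigenvector_of :: "real^'n^'n \<Rightarrow> real \<Rightarrow> real^'n \<Rightarrow> bool" where
  "eigenvector_of A \<mu> v \<longleftrightarrow> v \<noteq> 0 \<and> A *v v = \<mu> *\<^sub>R v"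

definition eigenvalues :: "real^'n^'n \<Rightarrow> real set" where
  "eigenvalues A = {\<mu>. \<exists>v. eigenvector_of A \<mu> v}"

text \<open>The eigenvalues of \<open>A\<close> are enumerated as \<open>lam 1, \<dots>, lam m\<close>; the values of \<open>lam\<close> outside
  \<open>{1..m}\<close> are irrelevant.\<close>

definition eig_gap :: "nat \<Rightarrow> (nat \<Rightarrow> real) \<Rightarrow> real" where
  "eig_gap m lam = Min {\<bar>lam k - lam l\<bar> | k l. k \<in> {1..m} \<and> l \<in> {1..m} \<and> k \<noteq> l}"

definition eigvec_matrices :: "real^'n^'n \<Rightarrow> (real^'n^'n) set" where
  "eigvec_matrices A = {X. orthogonal_matrix X \<and> is_diagonal (transpose X ** A ** X)}"

definition index_set :: "real^'n^'n \<Rightarrow> real \<Rightarrow> real^'n^'n \<Rightarrow> 'n set" where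
  "index_set A \<mu> X = {i. eigenvector_of A \<mu> (column i X)}"

definition class_of :: "nat \<Rightarrow> (nat \<Rightarrow> 'n set) \<Rightarrow> 'n \<Rightarrow> nat" where
  "class_of m I i = (THE k. k \<in> {1..m} \<and> i \<in> I k)"

definition near_corrections :: "real^'n^'n \<Rightarrow> real^'n^'n \<Rightarrow> (real^'n^'n) set" where
  "near_corrections A Xt = {E. Xt ** (mat 1 + E) \<in> eigvec_matrices A \<and> spectral_norm E < 1/3}"

definition corrections ::
  "real^'n^'n \<Rightarrow> nat \<Rightarrow> (nat \<Rightarrow> real) \<Rightarrow> real^'n^'n \<Rightarrow> (nat \<Rightarrow> 'n set) \<Rightarrow> (real^'n^'n) set" where
  "corrections A m lam Xt I = {E. Xt ** (mat 1 + E) \<in> eigvec_matrices A \<and>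
     (\<forall>k\<in>{1..m}. index_set A (lam k) (Xt ** (mat 1 + E)) = I k)}"

text \<open>The properties (i)--(iii) which characterize \<open>F\<^sup>*\<close>. The infimum below is a minimum whenever
  \<open>near_corrections A Xt\<close> is nonempty and \<open>Xt\<close> is invertible, see \<open>near_corrections_min\<close>.\<close>

definition is_F_star ::
  "real^'n^'n \<Rightarrow> nat \<Rightarrow> (nat \<Rightarrow> real) \<Rightarrow> real^'n^'n \<Rightarrow> (nat \<Rightarrow> 'n set) \<Rightarrow> real^'n^'n \<Rightarrow> bool" where
  "is_F_star A m lam Xt I F \<longleftrightarrow>
     F \<in> corrections A m lam Xt I \<and>
     spectral_norm F < 3 * (INF E\<in>near_corrections A Xt. spectral_norm E) \<and>
     3 * (INF E\<in>near_corrections A Xt. spectral_norm E) < 1 \<and>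
     (\<forall>k\<in>{1..m}. \<forall>i\<in>I k. \<forall>j\<in>I k. F $ i $ j = F $ j $ i)"

definition res_R :: "real^'n^'n \<Rightarrow> real^'n^'n" where
  "res_R Xt = mat 1 - transpose Xt ** Xt"

definition mat_S :: "real^'n^'n \<Rightarrow> real^'n^'n \<Rightarrow> real^'n^'n" where
  "mat_S A Xt = transpose Xt ** A ** Xt"

definition Delta :: "real^'n^'n \<Rightarrow> real^'n^'n" where
  "Delta F = matrix_inv (mat 1 + F) - mat 1 + F"

definition Delta1 :: "real^'n^'n \<Rightarrow> real^'n^'n" where
  "Delta1 F = Delta F + transpose (Delta F) + transpose (F - Delta F) ** (F - Delta F)"

definition Delta2 :: "real^'n^'n \<Rightarrow> real^'n^'n \<Rightarrow> real^'n^'n" where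
  "Delta2 F D = - (D ** Delta F) - transpose (D ** Delta F)
     - transpose (F - Delta F) ** D ** (F - Delta F)"

definition eq_a :: "real^'n^'n \<Rightarrow> real^'n^'n \<Rightarrow> 'n \<Rightarrow> 'n \<Rightarrow> bool" where
  "eq_a Xt F i j \<longleftrightarrow> F $ i $ j + F $ j $ i = res_R Xt $ i $ j + Delta1 F $ i $ j"

definition eq_b ::
  "real^'n^'n \<Rightarrow> real^'n^'n \<Rightarrow> real^'n^'n \<Rightarrow> real^'n \<Rightarrow> 'n \<Rightarrow> 'n \<Rightarrow> bool" where
  "eq_b A Xt F d i j \<longleftrightarrow>
     d $ i * (if i = j then 1 else 0) - d $ i * F $ i $ j - d $ j * F $ j $ i =
     mat_S A Xt $ i $ j + Delta2 F (diag_mat d) $ i $ j"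

text \<open>A pair \<open>(F, D)\<close> with \<open>D\<close> diagonal is represented by \<open>(F, d)\<close>, where \<open>d\<close> is the diagonal of
  \<open>D\<close>; so the unknown ranges over a Euclidean space of dimension \<open>n\<^sup>2 + n\<close>. The library norm of
  this product space is the one required, see \<open>norm_pair_frobenius\<close>.\<close>

definition solves_P ::
  "real^'n^'n \<Rightarrow> real^'n^'n \<Rightarrow> ('n \<Rightarrow> nat) \<Rightarrow> (real^'n^'n) \<times> (real^'n) \<Rightarrow> bool" where
  "solves_P A Xt K = (\<lambda>(F, d). spectral_norm F < 1 \<and>
     (\<forall>i j. eq_a Xt F i j) \<and>
     (\<forall>i j. eq_b A Xt F d i j) \<and>
     (\<forall>i j. K i = K j \<longrightarrow> F $ i $ j = F $ j $ i))"

definition solves_P' ::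
  "real^'n^'n \<Rightarrow> real^'n^'n \<Rightarrow> ('n \<Rightarrow> nat) \<Rightarrow> (real^'n^'n) \<times> (real^'n) \<Rightarrow> bool" where
  "solves_P' A Xt K = (\<lambda>(F, d). spectral_norm F < 1 \<and>
     (\<forall>i j. eq_a Xt F i j) \<and>
     (\<forall>i j. K i \<noteq> K j \<or> i = j \<longrightarrow> eq_b A Xt F d i j) \<and>
     (\<forall>i j. K i = K j \<longrightarrow> F $ i $ j = F $ j $ i))"

lemma norm_matrix_frobenius:
  fixes M :: "real^'n^'n"
  shows "norm M = sqrt (\<Sum>i\<in>UNIV. \<Sum>j\<in>UNIV. (M $ i $ j)\<^sup>2)"
  by (simp add: norm_vec_def L2_set_def sum_nonneg)

lemma norm_pair_frobenius:
  fixes F :: "real^'n^'n" and d :: "real^'n"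
  shows "norm (F, d) = sqrt ((norm F)\<^sup>2 + (norm (diag_mat d))\<^sup>2)"
proof -
  have "(\<Sum>j\<in>UNIV. (diag_mat d $ i $ j)\<^sup>2) = (d $ i)\<^sup>2" for i
    by (simp add: diag_mat_def if_distrib [of "\<lambda>x. x\<^sup>2"] cong: if_cong)
  then have "norm (diag_mat d) = norm d"
    by (simp add: norm_matrix_frobenius norm_vec_def [of d] L2_set_def)
  then show ?thesis by (simp add: norm_Pair)
qed

lemma compact_eigvec_matrices:
  fixes A :: "real^'n^'n"
  shows "compact (eigvec_matrices A)"
proof -
  have m: "continuous_on UNIV (\<lambda>X. transpose X ** B ** X)" for B :: "real^'n^'n"
    unfolding matrix_matrix_mult_def transpose_def
    by (intro continuous_on_vec_lambda) (auto intro!: continuous_intros)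
  have m2: "continuous_on UNIV (\<lambda>X. (transpose X ** A ** X) $ i $ j)" for i j
    by (intro continuous_on_component m)
  have eq: "eigvec_matrices A =
      {X. transpose X ** mat 1 ** X = mat 1} \<inter> (\<Inter>i. \<Inter>j\<in>-{i}. {X. (transpose X ** A ** X) $ i $ j = 0})"
    by (auto simp: eigvec_matrices_def is_diagonal_def orthogonal_matrix)
  have cl: "closed (eigvec_matrices A)"
    unfolding eq
    by (intro closed_Int closed_INT ballI closed_Collect_eq m m2 continuous_on_const)
  have "norm X \<le> sqrt (real CARD('n))" if "X \<in> eigvec_matrices A" for X
  proof -
    have "orthogonal_matrix (transpose X)"
      using that by (simp add: eigvec_matrices_def)
    then have "norm (X $ i) = 1" for i
      using orthogonal_matrix_orthonormal_columns[of "transpose X"]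
      by (simp add: column_def transpose_def)
    then show ?thesis by (simp add: norm_vec_def [of X] L2_set_def)
  qed
  then have "bounded (eigvec_matrices A)" by (auto simp: bounded_iff)
  with cl show ?thesis by (simp add: compact_eq_bounded_closed)
qed

lemma near_corrections_min:
  fixes A Xt :: "real^'n^'n"
  assumes "invertible Xt" and "near_corrections A Xt \<noteq> {}"
  shows "\<exists>E\<^sub>0\<in>near_corrections A Xt. (\<forall>E\<in>near_corrections A Xt. spectral_norm E\<^sub>0 \<le> spectral_norm E)
    \<and> (INF E\<in>near_corrections A Xt. spectral_norm E) = spectral_norm E\<^sub>0"
proof -
  obtain B where B: "B ** Xt = mat 1" "Xt ** B = mat 1"
    using assms(1) by (auto simp: invertible_def)
  have bl: "bounded_linear (\<lambda>x. M *v x)" for M :: "real^'n^'n"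
    by (rule matrix_vector_mul_bounded_linear)
  have lip: "\<bar>spectral_norm M - spectral_norm N\<bar> \<le> norm (M - N)" for M N :: "real^'n^'n"
  proof -
    have le: "spectral_norm P \<le> norm P" for P :: "real^'n^'n"
      unfolding spectral_norm_def
    proof (rule onorm_le)
      fix x :: "real^'n"
      have "norm (P *v x) \<le> L2_set (\<lambda>i. norm (P $ i) * norm x) UNIV"
        unfolding norm_vec_def [of "P *v x"]
        by (intro L2_set_mono) (auto simp: matrix_vector_mul_component Cauchy_Schwarz_ineq2)
      then show "norm (P *v x) \<le> norm P * norm x"
        by (simp add: L2_set_left_distrib [symmetric] norm_vec_def [of P])
    qed
    have tri: "spectral_norm M \<le> spectral_norm N + norm (M - N)" for M N :: "real^'n^'n"
    proof -
      have "spectral_norm M \<le> spectral_norm N + spectral_norm (M - N)"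
        using onorm_triangle[OF bl[of N] bl[of "M - N"]]
        by (simp add: spectral_norm_def matrix_vector_mult_diff_rdistrib)
      with le[of "M - N"] show ?thesis by linarith
    qed
    show ?thesis using tri[of M N] tri[of N M] by (simp add: norm_minus_commute)
  qed
  have "continuous_on UNIV (spectral_norm :: real^'n^'n \<Rightarrow> real)"
    unfolding continuous_on_iff dist_norm real_norm_def by (meson lip le_less_trans)
  moreover have "continuous_on (eigvec_matrices A) (\<lambda>X. B ** X - mat 1)"
    unfolding matrix_matrix_mult_def
    by (intro continuous_on_diff continuous_on_vec_lambda) (auto intro!: continuous_intros)
  ultimately have cont: "continuous_on (eigvec_matrices A) (\<lambda>X. spectral_norm (B ** X - mat 1))"
    by (rule continuous_on_compose2) simp
  have cancel: "B ** (Xt ** (mat 1 + E)) - mat 1 = E" for E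
    by (simp add: matrix_mul_assoc B)
  obtain E1 where E1: "E1 \<in> near_corrections A Xt" using assms(2) by auto
  then have "eigvec_matrices A \<noteq> {}" by (auto simp: near_corrections_def)
  from continuous_attains_inf[OF compact_eigvec_matrices this cont]
  obtain X where X: "X \<in> eigvec_matrices A"
    and least: "\<And>Y. Y \<in> eigvec_matrices A \<Longrightarrow>
      spectral_norm (B ** X - mat 1) \<le> spectral_norm (B ** Y - mat 1)" by blast
  define E0 where "E0 = B ** X - mat 1"
  have le: "spectral_norm E0 \<le> spectral_norm E" if "E \<in> near_corrections A Xt" for E
    using least[of "Xt ** (mat 1 + E)"] that by (simp add: near_corrections_def cancel E0_def)
  have "Xt ** (mat 1 + E0) = X" by (simp add: E0_def matrix_mul_assoc B)
  then have "E0 \<in> near_corrections A Xt"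
    using X le[OF E1] E1 by (auto simp: near_corrections_def)
  moreover have "(INF E\<in>near_corrections A Xt. spectral_norm E) = spectral_norm E0"
    using \<open>E0 \<in> near_corrections A Xt\<close> by (intro cInf_eq_minimum) (auto simp: le)
  ultimately show ?thesis using le by blast
qed

end

theory Submission
  imports Defs
begin

text \<open>
  Write \<open>G = (I + F)\<^sup>-\<^sup>1\<close>, so that \<open>F - \<Delta>(F) = I - G\<close>. Substituting this into the definitions
  of \<open>\<Delta>\<^sub>1\<close> and \<open>\<Delta>\<^sub>2\<close> cancels every linear term: equation (a) says
  \<open>G\<^sup>T G = Xt\<^sup>T Xt\<close> and equation (b) says \<open>G\<^sup>T D G = Xt\<^sup>T A Xt\<close>, entry by entry
  (\<open>eq_a_iff\<close>, \<open>eq_b_iff\<close>). For \<open>F = F*\<close> the matrix \<open>Xt\<close> equals \<open>X* G\<close> with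
  \<open>X*\<close> orthogonal and \<open>X*\<^sup>T A X* = D*\<close>, so both equations hold at all indices
  (\<open>correction_solves\<close>), and \<open>z*\<close> solves problem P.

  For uniqueness, compare a solution \<open>(F', d)\<close> of problem P' with \<open>z* = (F, c)\<close>. Put
  \<open>P = F' - \<Delta>(F')\<close> and \<open>Q = F - \<Delta>(F)\<close>, both of norm at most a small number \<open>p\<close>, and let
  \<open>q = P - Q\<close>, \<open>e = d - c\<close>, \<open>w = \<parallel>q\<parallel> + \<parallel>e\<parallel>\<close>. Subtracting the two sets of equations leaves, up
  to errors of size \<open>O(p w)\<close>, the linear system

  \<^item> \<open>q\<^sub>i\<^sub>j + q\<^sub>j\<^sub>i = 0\<close> for all \<open>i, j\<close>, from (a);

  \<^item> \<open>c\<^sub>i q\<^sub>i\<^sub>j + c\<^sub>j q\<^sub>j\<^sub>i = \<delta>\<^sub>i\<^sub>j e\<^sub>i\<close> for \<open>i = j\<close> or \<open>i, j\<close> in different classes, from (b);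

  \<^item> \<open>q\<^sub>i\<^sub>j = q\<^sub>j\<^sub>i\<close> for \<open>i, j\<close> in the same class, from (c), since \<open>q\<close> agrees with
    \<open>F' - F\<close> to first order.

  The \<open>c\<^sub>i\<close> are the eigenvalues of \<open>A\<close>, so \<open>\<bar>c\<^sub>i - c\<^sub>j\<bar>\<close> is at least the gap \<open>\<eta>\<close> for indices in
  different classes. The first two families then determine the entries of \<open>q\<close> between classes,
  the first and third those inside a class, and the second at \<open>i = j\<close> determines \<open>e\<close>; the only
  solution of the linear system is zero. Quantitatively \<open>w \<le> C p w\<close>, where \<open>C\<close> depends only on \<open>n\<close>,
  \<open>\<eta>\<close> and the size of the eigenvalues, hence \<open>w = 0\<close> as soon as \<open>C p < 1\<close>
  (\<open>linearized_uniqueness\<close>). Since \<open>\<delta> < \<parallel>F*\<parallel>\<^sub>2 < \<epsilon>\<close>, choosing \<open>\<epsilon>\<close> proportional to such a \<open>p\<close>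
  makes \<open>p\<close> a bound throughout the ball.

  All estimates use the Frobenius norm, which is the norm of the type of matrices and is
  submultiplicative and invariant under transposition.
\<close>

section \<open>Matrix algebra and the Frobenius norm\<close>

lemma matrix_mult_bilinear:
  fixes M N K :: "real^'n^'n"
  shows "M ** (N + K) = M ** N + M ** K" "(M + N) ** K = M ** K + N ** K"
    "M ** (N - K) = M ** N - M ** K" "(M - N) ** K = M ** K - N ** K"
  by (simp_all add: matrix_matrix_mult_def vec_eq_iff algebra_simps sum.distrib sum_subtractf)

lemma transpose_linear:
  fixes M N :: "real^'n^'n"
  shows "transpose (M + N) = transpose M + transpose N"
    "transpose (M - N) = transpose M - transpose N"
  by (simp_all add: transpose_def vec_eq_iff)

lemma transpose_diag_mat [simp]: "transpose (diag_mat d) = diag_mat d"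
  by (simp add: transpose_def diag_mat_def vec_eq_iff)

lemma diag_mat_diff: "diag_mat d - diag_mat e = diag_mat (d - e)"
  by (simp add: diag_mat_def vec_eq_iff)

lemma diag_mat_mult_component:
  "(diag_mat d ** M) $ i $ j = d $ i * M $ i $ j"
  "(M ** diag_mat d) $ i $ j = M $ i $ j * d $ j"
  by (simp_all add: matrix_matrix_mult_def diag_mat_def if_distrib [of "\<lambda>x. x * _"]
      if_distrib [of "\<lambda>x. _ * x"] cong: if_cong)

lemma norm_diag_mat: "norm (diag_mat d) = norm d"
  using norm_pair_frobenius[of 0 d] by (simp add: norm_Pair)

lemma abs_entry_le_norm:
  fixes M :: "real^'n^'n"
  shows "\<bar>M $ i $ j\<bar> \<le> norm M"
  using component_le_norm_cart[of "M $ i" j] Finite_Cartesian_Product.norm_nth_le[of M i] by simp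

lemma norm_le_sum_entries:
  fixes M :: "real^'n^'n"
  shows "norm M \<le> (\<Sum>i\<in>UNIV. \<Sum>j\<in>UNIV. \<bar>M $ i $ j\<bar>)"
proof -
  have "norm M \<le> (\<Sum>i\<in>UNIV. norm (M $ i))"
    unfolding norm_vec_def by (intro L2_set_le_sum) auto
  also have "\<dots> \<le> (\<Sum>i\<in>UNIV. \<Sum>j\<in>UNIV. \<bar>M $ i $ j\<bar>)"
    by (intro sum_mono norm_le_l1_cart)
  finally show ?thesis .
qed

lemma norm_transpose [simp]:
  fixes M :: "real^'n^'n"
  shows "norm (transpose M) = norm M"
  unfolding norm_matrix_frobenius transpose_def by (simp, subst sum.swap, simp)

lemma norm_matrix_vector_mult_le:
  fixes M :: "real^'n^'n"
  shows "norm (M *v x) \<le> norm M * norm x"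
proof -
  have "norm (M *v x) \<le> L2_set (\<lambda>i. norm (M $ i) * norm x) UNIV"
    unfolding norm_vec_def [of "M *v x"]
    by (intro L2_set_mono) (auto simp: matrix_vector_mul_component Cauchy_Schwarz_ineq2)
  then show ?thesis
    by (simp add: L2_set_left_distrib [symmetric] norm_vec_def [of M])
qed

text \<open>Column \<open>i\<close> of \<open>M N\<close> is \<open>M\<close> applied to column \<open>i\<close> of \<open>N\<close>; passing to the transpose makes
  columns accessible as vectors of the matrix type.\<close>

lemma norm_matrix_mult_le:
  fixes M N :: "real^'n^'n"
  shows "norm (M ** N) \<le> norm M * norm N"
proof -
  have row: "transpose (M ** N) $ i = M *v (transpose N $ i)" for i
    by (simp add: transpose_def matrix_matrix_mult_def matrix_vector_mult_def vec_eq_iff)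
  have "norm (transpose (M ** N)) \<le> L2_set (\<lambda>i. norm M * norm (transpose N $ i)) UNIV"
    unfolding norm_vec_def [of "transpose (M ** N)"] row
    by (intro L2_set_mono norm_matrix_vector_mult_le) auto
  also have "\<dots> = norm M * norm (transpose N)"
    unfolding norm_vec_def [of "transpose N"] by (simp add: L2_set_right_distrib)
  finally show ?thesis by simp
qed

lemma norm_mult_vec_le_spectral_norm: "norm (M *v x) \<le> spectral_norm M * norm x"
  unfolding spectral_norm_def by (intro onorm matrix_vector_mul_bounded_linear)

text \<open>Each of the \<open>n\<close> columns is the image of a unit vector. The constant \<open>n\<close> could be sharpened to
  its square root, but only its dependence on \<open>n\<close> alone matters.\<close>

lemma norm_le_card_spectral_norm:
  fixes M :: "real^'n^'n"
  shows "norm M \<le> real CARD('n) * spectral_norm M"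
proof -
  have "norm (transpose M $ j) \<le> spectral_norm M" for j
    using norm_column_le_onorm[of j M]
    by (simp add: spectral_norm_def column_def transpose_def)
  moreover have "norm (transpose M) \<le> (\<Sum>j\<in>UNIV. norm (transpose M $ j))"
    unfolding norm_vec_def [of "transpose M"] by (intro L2_set_le_sum) auto
  ultimately have "norm (transpose M) \<le> (\<Sum>j\<in>(UNIV::'n set). spectral_norm M)"
    by (meson order_trans sum_mono)
  then show ?thesis by simp
qed

section \<open>The equations in terms of the inverse of \<open>I + F\<close>\<close>

lemma inverse_one_plus:
  fixes F :: "real^'n^'n"
  assumes "spectral_norm F < 1"
  shows "(mat 1 + F) ** matrix_inv (mat 1 + F) = mat 1"
    and "matrix_inv (mat 1 + F) ** (mat 1 + F) = mat 1"
proof -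
  have "x = 0" if "(mat 1 + F) *v x = 0" for x
  proof (rule ccontr)
    assume "x \<noteq> 0"
    have "F *v x = - x"
      using that by (simp add: matrix_vector_mult_add_rdistrib add_eq_0_iff)
    then have "norm x \<le> spectral_norm F * norm x"
      using norm_mult_vec_le_spectral_norm[of F x] by simp
    with assms \<open>x \<noteq> 0\<close> show False by simp
  qed
  then have "invertible (mat 1 + F)"
    by (simp add: invertible_left_inverse matrix_left_invertible_ker)
  then have "\<exists>B. (mat 1 + F) ** B = mat 1 \<and> B ** (mat 1 + F) = mat 1"
    by (simp add: invertible_def)
  from someI_ex[OF this]
  show "(mat 1 + F) ** matrix_inv (mat 1 + F) = mat 1"
    and "matrix_inv (mat 1 + F) ** (mat 1 + F) = mat 1"
    by (simp_all add: matrix_inv_def)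
qed

lemma minus_Delta: "F - Delta F = mat 1 - matrix_inv (mat 1 + F)"
  by (simp add: Delta_def)

text \<open>Equations (a) and (b) arise from \<open>G\<^sup>T G = Xt\<^sup>T Xt\<close> and \<open>G\<^sup>T D G = Xt\<^sup>T A Xt\<close> by substituting
  \<open>G = I - F + \<Delta>(F)\<close> and moving everything beyond the linear part in \<open>F\<close> to the right-hand side.
  Undoing this is a purely algebraic identity.\<close>

lemma eq_a_iff:
  fixes Xt F :: "real^'n^'n"
  defines "G \<equiv> matrix_inv (mat 1 + F)"
  shows "eq_a Xt F i j \<longleftrightarrow> (transpose G ** G) $ i $ j = (transpose Xt ** Xt) $ i $ j"
proof -
  have "res_R Xt + Delta1 F - (F + transpose F) = transpose G ** G - transpose Xt ** Xt"
    by (simp add: res_R_def Delta1_def Delta_def G_def matrix_mult_bilinear transpose_linear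
        algebra_simps)
  then have "(res_R Xt + Delta1 F - (F + transpose F)) $ i $ j
      = (transpose G ** G - transpose Xt ** Xt) $ i $ j" by simp
  then show ?thesis by (auto simp: eq_a_def transpose_def)
qed

lemma eq_b_iff:
  fixes A Xt F :: "real^'n^'n"
  defines "G \<equiv> matrix_inv (mat 1 + F)"
  shows "eq_b A Xt F d i j \<longleftrightarrow> (transpose G ** diag_mat d ** G) $ i $ j = mat_S A Xt $ i $ j"
proof -
  define D where "D = diag_mat d"
  have "D - D ** F - transpose F ** D - Delta2 F D = transpose G ** D ** G"
    by (simp add: Delta2_def Delta_def G_def D_def matrix_mult_bilinear transpose_linear
        matrix_transpose_mul matrix_mul_assoc algebra_simps)
  then have "(D - D ** F - transpose F ** D - Delta2 F D) $ i $ j = (transpose G ** D ** G) $ i $ j"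
    by (simp only:)
  moreover have comp: "D $ i $ j = d $ i * (if i = j then 1 else 0)"
    "(D ** F) $ i $ j = d $ i * F $ i $ j" "(transpose F ** D) $ i $ j = d $ j * F $ j $ i"
    by (simp_all add: D_def diag_mat_mult_component) (simp_all add: diag_mat_def transpose_def)
  ultimately have "(transpose G ** D ** G) $ i $ j
     = d $ i * (if i = j then 1 else 0) - d $ i * F $ i $ j - d $ j * F $ j $ i - Delta2 F D $ i $ j"
    by (simp add: comp)
  then show ?thesis by (auto simp: eq_b_def D_def)
qed

text \<open>With \<open>P = F - \<Delta>(F) = I - (I + F)\<^sup>-\<^sup>1\<close> one has \<open>P = F - F P\<close>, and \<open>\<parallel>F P\<parallel>\<close> is at most
  half of \<open>\<parallel>P\<parallel>\<close>.\<close>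

lemma norm_minus_Delta_le:
  fixes F :: "real^'n^'n"
  assumes "spectral_norm F < 1" "norm F \<le> 1/2"
  shows "norm (F - Delta F) \<le> 2 * norm F"
proof -
  define P where "P = F - Delta F"
  have "matrix_inv (mat 1 + F) = mat 1 - P"
    using minus_Delta[of F] by (simp add: P_def)
  then have "(mat 1 + F) ** (mat 1 - P) = mat 1"
    using inverse_one_plus(1)[OF assms(1)] by simp
  then have "P = F - F ** P"
    by (simp add: matrix_mult_bilinear algebra_simps)
  then have "norm P \<le> norm F + norm (F ** P)"
    using norm_triangle_ineq4[of F "F ** P"] by simp
  also have "\<dots> \<le> norm F + 1/2 * norm P"
    using norm_matrix_mult_le[of F P] mult_right_mono[OF assms(2), of "norm P"] by simp
  finally show ?thesis by (simp add: P_def)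
qed

text \<open>The resolvent identity for \<open>(I + F)\<^sup>-\<^sup>1 = I - P\<close>.\<close>

lemma minus_Delta_diff:
  fixes F F' :: "real^'n^'n"
  assumes "spectral_norm F < 1" "spectral_norm F' < 1"
  defines "P \<equiv> F - Delta F" and "P' \<equiv> F' - Delta F'"
  shows "P - P' = (mat 1 - P) ** (F - F') ** (mat 1 - P')"
proof -
  have G: "matrix_inv (mat 1 + F) = mat 1 - P" "matrix_inv (mat 1 + F') = mat 1 - P'"
    using minus_Delta[of F] minus_Delta[of F'] by (simp_all add: P_def P'_def)
  have "(mat 1 - P) ** (F - F') ** (mat 1 - P')
      = (mat 1 - P) ** (mat 1 + F) ** (mat 1 - P') - (mat 1 - P) ** ((mat 1 + F') ** (mat 1 - P'))"
    by (simp add: matrix_mult_bilinear matrix_mul_assoc)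
  also have "\<dots> = P - P'"
    using inverse_one_plus[OF assms(1)] inverse_one_plus[OF assms(2)] by (simp add: G)
  finally show ?thesis by simp
qed


section \<open>Linearization and uniqueness\<close>

lemma norm_triple_mult_le:
  fixes M N K :: "real^'n^'n"
  assumes "norm M \<le> a" "norm N \<le> b" "norm K \<le> c"
  shows "norm (M ** N ** K) \<le> a * b * c"
proof -
  have "norm (M ** N ** K) \<le> norm (M ** N) * norm K" by (rule norm_matrix_mult_le)
  also have "\<dots> \<le> norm M * norm N * norm K"
    by (intro mult_right_mono norm_matrix_mult_le) auto
  also have "\<dots> \<le> a * b * c"
    using assms norm_ge_zero[of M] norm_ge_zero[of N] norm_ge_zero[of K]
    by (intro mult_mono mult_nonneg_nonneg) linarith+
  finally show ?thesis .
qed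

text \<open>Equation (a) for both solutions: expanding the two Gram matrices gives
  \<open>q + q\<^sup>T = q\<^sup>T P + Q\<^sup>T q\<close>, with a right-hand side that is small relative to \<open>q = P - Q\<close>.\<close>

lemma gram_linearization:
  fixes P Q :: "real^'n^'n"
  assumes "\<And>i j. (transpose (mat 1 - P) ** (mat 1 - P)) $ i $ j
      = (transpose (mat 1 - Q) ** (mat 1 - Q)) $ i $ j"
    and "norm P \<le> p" "norm Q \<le> p"
  shows "\<bar>(P - Q) $ i $ j + (P - Q) $ j $ i\<bar> \<le> 2 * p * norm (P - Q)"
proof -
  define q where "q = P - Q"
  have "transpose (mat 1 - P) ** (mat 1 - P) = transpose (mat 1 - Q) ** (mat 1 - Q)"
    using assms(1) by (simp add: vec_eq_iff)
  then have "q + transpose q = transpose q ** P + transpose Q ** q"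
    by (simp add: q_def matrix_mult_bilinear transpose_linear algebra_simps)
  then have "norm (q + transpose q) \<le> norm (transpose q ** P) + norm (transpose Q ** q)"
    by (simp add: norm_triangle_ineq)
  also have "\<dots> \<le> norm q * norm P + norm Q * norm q"
    using norm_matrix_mult_le[of "transpose q" P] norm_matrix_mult_le[of "transpose Q" q]
    by simp
  also have "\<dots> \<le> norm q * p + p * norm q"
    using assms by (intro add_mono mult_left_mono mult_right_mono) auto
  finally have "norm (q + transpose q) \<le> 2 * p * norm q" by simp
  moreover have "\<bar>q $ i $ j + q $ j $ i\<bar> \<le> norm (q + transpose q)"
    using abs_entry_le_norm[of "q + transpose q" i j] by (simp add: transpose_def)
  ultimately show ?thesis by (simp add: q_def)
qed

text \<open>Equation (b) for both solutions, at a single index. In the expansion below the quadratic terms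
  are telescoped so that the coefficients are the diagonal matrix \<open>diag_mat c\<close> of the reference
  solution, whose norm is controlled by the spectrum of \<open>A\<close>, and the difference \<open>d - c\<close>.\<close>

lemma congruence_linearization:
  fixes P Q :: "real^'n^'n"
  assumes "(transpose (mat 1 - P) ** diag_mat d ** (mat 1 - P)) $ i $ j
      = (transpose (mat 1 - Q) ** diag_mat c ** (mat 1 - Q)) $ i $ j"
    and "norm P \<le> p" "norm Q \<le> p" "norm c \<le> L" "p \<le> 1"
  shows "\<bar>(if i = j then (d - c) $ i else 0) - c $ i * (P - Q) $ i $ j - c $ j * (P - Q) $ j $ i\<bar>
      \<le> p * (3 * norm (d - c) + 2 * L * norm (P - Q))"
proof -
  define q where "q = P - Q"
  define C where "C = diag_mat c"
  define E where "E = diag_mat (d - c)"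
  define err where "err = E ** P + transpose P ** E - transpose P ** E ** P
      - transpose q ** C ** P - transpose Q ** C ** q"
  have P: "P = Q + q" and d: "diag_mat d = C + E"
    by (simp_all add: q_def C_def E_def flip: diag_mat_diff)
  have "transpose (mat 1 - P) ** diag_mat d ** (mat 1 - P)
      - transpose (mat 1 - Q) ** diag_mat c ** (mat 1 - Q) = E - C ** q - transpose q ** C - err"
    unfolding d err_def P C_def [symmetric]
    by (simp add: matrix_mult_bilinear transpose_linear algebra_simps)
  then have "(E - C ** q - transpose q ** C) $ i $ j = err $ i $ j"
    using assms(1) by (simp add: vec_eq_iff) (metis eq_iff_diff_eq_0)
  moreover have "(E - C ** q - transpose q ** C) $ i $ j
      = (if i = j then (d - c) $ i else 0) - c $ i * q $ i $ j - c $ j * q $ j $ i"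
    by (simp add: C_def E_def diag_mat_mult_component)
       (simp add: diag_mat_def transpose_def)
  moreover have "\<bar>err $ i $ j\<bar> \<le> norm err" by (rule abs_entry_le_norm)
  moreover have "norm err \<le> p * (3 * norm (d - c) + 2 * L * norm q)"
  proof -
    have p0: "0 \<le> p" using assms(2) norm_ge_zero order_trans by blast
    have E: "norm E = norm (d - c)" and C: "norm C \<le> L"
      using assms(4) by (simp_all add: E_def C_def norm_diag_mat)
    have "norm (E ** P) \<le> norm E * p" "norm (transpose P ** E) \<le> p * norm E"
      using norm_matrix_mult_le[of E P] norm_matrix_mult_le[of "transpose P" E]
        mult_left_mono[OF assms(2), of "norm E"] mult_right_mono[OF assms(2), of "norm E"]
      by auto
    moreover have "norm (transpose P ** E ** P) \<le> p * norm E * 1"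
      using assms(2,5) by (intro norm_triple_mult_le) auto
    moreover have "norm (transpose q ** C ** P) \<le> norm q * L * p"
      "norm (transpose Q ** C ** q) \<le> p * L * norm q"
      using assms(2,3) C by (intro norm_triple_mult_le; simp)+
    moreover have "norm err \<le> norm (E ** P) + norm (transpose P ** E) + norm (transpose P ** E ** P)
       + norm (transpose q ** C ** P) + norm (transpose Q ** C ** q)"
      unfolding err_def by (intro order_trans [OF norm_triangle_ineq4] add_mono norm_triangle_ineq order_refl)
    ultimately show ?thesis unfolding E by (simp add: algebra_simps)
  qed
  ultimately show ?thesis by (simp add: q_def)
qed

text \<open>The symmetry condition (c) constrains \<open>h = F' - F\<close>, whereas (a) and (b) constrain \<open>P - Q\<close>.
  The two differences agree to first order, so the condition carries over with a small error.\<close>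

lemma difference_linearization:
  fixes P Q h :: "real^'n^'n"
  assumes "P - Q = (mat 1 - P) ** h ** (mat 1 - Q)"
    and "norm P \<le> p" "norm Q \<le> p" "p \<le> 1/6"
  shows "norm (h - (P - Q)) \<le> 6 * p * norm (P - Q)"
    and "norm h \<le> 2 * norm (P - Q)"
proof -
  have "h - (P - Q) = P ** h + h ** Q - P ** h ** Q"
    by (subst assms(1)) (simp add: matrix_mult_bilinear matrix_mul_assoc)
  then have "norm (h - (P - Q)) \<le> norm (P ** h) + norm (h ** Q) + norm (P ** h ** Q)"
    by (simp only:) (intro order_trans [OF norm_triangle_ineq4] add_mono norm_triangle_ineq order_refl)
  moreover have "norm (P ** h) \<le> p * norm h" "norm (h ** Q) \<le> norm h * p"
      using norm_matrix_mult_le[of P h] norm_matrix_mult_le[of h Q]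
        mult_left_mono[OF assms(3), of "norm h"] mult_right_mono[OF assms(2), of "norm h"]
      by auto
  moreover have "norm (P ** h ** Q) \<le> p * norm h * 1"
    using assms by (intro norm_triple_mult_le) auto
  ultimately have 1: "norm (h - (P - Q)) \<le> 3 * p * norm h" by (simp add: algebra_simps)
  also have "\<dots> \<le> 1/2 * norm h"
    using assms(4) by (intro mult_right_mono) auto
  finally have "norm (h - (P - Q)) \<le> 1/2 * norm h" .
  then show 2: "norm h \<le> 2 * norm (P - Q)"
    using norm_triangle_ineq[of "h - (P - Q)" "P - Q"] by simp
  have "0 \<le> p" using assms(2) norm_ge_zero order_trans by blast
  then have "3 * p * norm h \<le> 3 * p * (2 * norm (P - Q))"
    by (intro mult_left_mono[OF 2]) auto
  with 1 show "norm (h - (P - Q)) \<le> 6 * p * norm (P - Q)" by simp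
qed

text \<open>The bound for the inverse of the linearized system, together with the constants of the error
  terms. The first summand adds up bounds for the \<open>n\<^sup>2\<close> entries of \<open>P - Q\<close>, where \<open>7\<close> comes from
  pairs in the same class and \<open>(3 + 4 L) / \<eta>\<close> from the other pairs; the second one adds up bounds
  for the \<open>n\<close> entries of \<open>d - c\<close>.\<close>

definition contraction_const :: "nat \<Rightarrow> real \<Rightarrow> real \<Rightarrow> real" where
  "contraction_const n \<eta> L =
     (real n)\<^sup>2 * (7 + (3 + 4 * L) / \<eta>) + real n * (3 + 4 * L)"

text \<open>The errors \<open>O(p w)\<close> are propagated through the entrywise solution of the linear system.
  Between classes, eliminating \<open>q\<^sub>j\<^sub>i\<close> leaves \<open>(c\<^sub>i - c\<^sub>j) q\<^sub>i\<^sub>j\<close>, and this is where the spectral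
  gap enters. Inside a class (b) would carry no information about \<open>q\<^sub>i\<^sub>j\<close>, because
  for eigenvalues \<open>c\<^sub>i = c\<^sub>j\<close> makes it a multiple of (a) to first order; there symmetry closes the system.\<close>

lemma linearized_uniqueness:
  fixes P Q h :: "real^'n^'n" and K :: "'n \<Rightarrow> nat"
  assumes h: "P - Q = (mat 1 - P) ** h ** (mat 1 - Q)"
    and a: "\<And>i j. (transpose (mat 1 - P) ** (mat 1 - P)) $ i $ j
      = (transpose (mat 1 - Q) ** (mat 1 - Q)) $ i $ j"
    and b: "\<And>i j. K i \<noteq> K j \<or> i = j \<Longrightarrow> (transpose (mat 1 - P) ** diag_mat d ** (mat 1 - P)) $ i $ j
      = (transpose (mat 1 - Q) ** diag_mat c ** (mat 1 - Q)) $ i $ j"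
    and sym: "\<And>i j. K i = K j \<Longrightarrow> h $ i $ j = h $ j $ i"
    and gap: "\<And>i j. K i \<noteq> K j \<Longrightarrow> \<eta> \<le> \<bar>c $ i - c $ j\<bar>" and "\<eta> > 0"
    and bounds: "norm P \<le> p" "norm Q \<le> p" "p \<le> 1/6" "norm c \<le> L"
    and small: "contraction_const CARD('n) \<eta> L * p < 1"
  shows "h = 0" and "d = c"
proof -
  define q where "q = P - Q"
  define e where "e = d - c"
  define w where "w = norm q + norm e"
  have p0: "0 \<le> p" using bounds(1) norm_ge_zero order_trans by blast
  have L0: "0 \<le> L" using bounds(4) norm_ge_zero order_trans by blast
  have le_w: "norm q \<le> w" "norm e \<le> w" and w0: "0 \<le> w" by (simp_all add: w_def)
  have c: "\<bar>c $ i\<bar> \<le> L" for i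
    using component_le_norm_cart[of c i] bounds(4) by simp
  have A: "\<bar>q $ i $ j + q $ j $ i\<bar> \<le> 2 * p * w" for i j
  proof -
    have "\<bar>q $ i $ j + q $ j $ i\<bar> \<le> 2 * p * norm q"
      using gram_linearization[OF a bounds(1,2)] by (simp add: q_def)
    also have "\<dots> \<le> 2 * p * w" using le_w p0 by (intro mult_left_mono) auto
    finally show ?thesis .
  qed
  have B: "\<bar>(if i = j then e $ i else 0) - c $ i * q $ i $ j - c $ j * q $ j $ i\<bar>
      \<le> (3 + 2 * L) * p * w" if "K i \<noteq> K j \<or> i = j" for i j
  proof -
    have "p * (3 * norm e + 2 * L * norm q) \<le> p * (3 * w + 2 * L * w)"
      using le_w p0 L0 by (intro mult_left_mono add_mono) auto
    moreover have "\<bar>(if i = j then e $ i else 0) - c $ i * q $ i $ j - c $ j * q $ j $ i\<bar>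
        \<le> p * (3 * norm e + 2 * L * norm q)"
      unfolding q_def e_def using bounds by (intro congruence_linearization b that) auto
    ultimately show ?thesis by (simp add: algebra_simps)
  qed
  have cA: "\<bar>c $ j * (q $ i $ j + q $ j $ i)\<bar> \<le> L * (2 * p * w)" for i j
    unfolding abs_mult using c[of j] A[of i j] L0 by (intro mult_mono) auto
  have same: "\<bar>q $ i $ j\<bar> \<le> 7 * p * w" if "K i = K j" for i j
  proof -
    have "norm (h - q) \<le> 6 * p * norm q"
      using difference_linearization(1)[OF h bounds(1-3)] by (simp add: q_def)
    also have "\<dots> \<le> 6 * p * w" using le_w p0 by (intro mult_left_mono) auto
    finally have "\<bar>(h - q) $ i $ j\<bar> \<le> 6 * p * w" "\<bar>(h - q) $ j $ i\<bar> \<le> 6 * p * w"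
      using abs_entry_le_norm[of "h - q" i j] abs_entry_le_norm[of "h - q" j i] by linarith+
    then have "\<bar>q $ i $ j - q $ j $ i\<bar> \<le> 12 * (p * w)"
      using sym[OF that] by simp
    then show ?thesis using A[of i j] by simp
  qed
  have other: "\<bar>q $ i $ j\<bar> \<le> (3 + 4 * L) / \<eta> * p * w" if "K i \<noteq> K j" for i j
  proof -
    have "i \<noteq> j" using that by auto
    have "(c $ i - c $ j) * q $ i $ j
        = (c $ i * q $ i $ j + c $ j * q $ j $ i) - c $ j * (q $ i $ j + q $ j $ i)"
      by (simp add: algebra_simps)
    also have "\<bar>\<dots>\<bar> \<le> (3 + 2 * L) * p * w + L * (2 * p * w)"
      using B[of i j] cA[of j i] that \<open>i \<noteq> j\<close> by simp
    also have "\<dots> = (3 + 4 * L) * p * w" by (simp add: algebra_simps)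
    finally have "\<bar>c $ i - c $ j\<bar> * \<bar>q $ i $ j\<bar> \<le> (3 + 4 * L) * p * w"
      by (simp add: abs_mult)
    moreover have "\<eta> * \<bar>q $ i $ j\<bar> \<le> \<bar>c $ i - c $ j\<bar> * \<bar>q $ i $ j\<bar>"
      using gap[OF that] by (intro mult_right_mono) auto
    ultimately show ?thesis using \<open>\<eta> > 0\<close> by (simp add: field_simps)
  qed
  have Q: "\<bar>q $ i $ j\<bar> \<le> (7 + (3 + 4 * L) / \<eta>) * p * w" for i j
  proof -
    have "0 \<le> 7 * p * w" "0 \<le> (3 + 4 * L) / \<eta> * p * w"
      using p0 w0 L0 \<open>\<eta> > 0\<close> by auto
    then show ?thesis
      using same[of i j] other[of i j] by (cases "K i = K j") (simp_all add: algebra_simps)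
  qed
  have D: "\<bar>e $ i\<bar> \<le> (3 + 4 * L) * p * w" for i
  proof -
    have "\<bar>e $ i\<bar> \<le> (3 + 2 * L) * p * w + L * (2 * p * w)"
      using B[of i i] cA[of i i] by (simp add: algebra_simps)
    then show ?thesis by (simp add: algebra_simps)
  qed
  have "norm q \<le> (\<Sum>i\<in>(UNIV::'n set). \<Sum>j\<in>(UNIV::'n set). (7 + (3 + 4 * L) / \<eta>) * p * w)"
    using norm_le_sum_entries[of q] by (rule order_trans) (intro sum_mono Q)
  moreover have "norm e \<le> (\<Sum>i\<in>(UNIV::'n set). (3 + 4 * L) * p * w)"
    using norm_le_l1_cart[of e] by (rule order_trans) (intro sum_mono D)
  ultimately have "w \<le> contraction_const CARD('n) \<eta> L * p * w"
    by (simp add: w_def contraction_const_def power2_eq_square algebra_simps)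
  then have "w = 0"
    using small w0 mult_right_mono[of "contraction_const CARD('n) \<eta> L * p" 1 w]
    by (smt (verit) mult_less_cancel_right2)
  then have "norm q = 0" "norm e = 0"
    using norm_ge_zero[of q] norm_ge_zero[of e] unfolding w_def by linarith+
  then show "h = 0" "d = c"
    using difference_linearization(2)[OF h bounds(1-3)] by (simp_all add: q_def e_def)
qed

section \<open>Eigenvector matrices and the local uniqueness theorem\<close>

text \<open>Orthogonality turns diagonality of \<open>X\<^sup>T A X = D\<close> into \<open>A X = X D\<close>, so the columns are
  eigenvectors whose eigenvalues can be read off the diagonal.\<close>

lemma index_set_eigvec_matrix:
  fixes A X :: "real^'n^'n"
  assumes "X \<in> eigvec_matrices A"
  shows "index_set A \<mu> X = {i. (transpose X ** A ** X) $ i $ i = \<mu>}"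
proof -
  define D where "D = transpose X ** A ** X"
  have D: "D $ i $ j = 0" if "i \<noteq> j" for i j
    using assms that by (simp add: eigvec_matrices_def is_diagonal_def D_def)
  have orth: "orthogonal_matrix X" using assms by (simp add: eigvec_matrices_def)
  then have "X ** D = A ** X"
    by (simp add: D_def matrix_mul_assoc orthogonal_matrix_def)
  then have "(A *v column i X) $ r = (X ** D) $ r $ i" for i r
    by (simp add: matrix_vector_mult_def matrix_matrix_mult_def column_def vec_eq_iff)
  moreover have "(X ** D) $ r $ i = D $ i $ i * X $ r $ i" for i r
  proof -
    have "(\<Sum>s\<in>UNIV. X $ r $ s * D $ s $ i) = (\<Sum>s\<in>UNIV. if s = i then X $ r $ i * D $ i $ i else 0)"
      by (intro sum.cong) (auto simp: D)
    then show ?thesis by (simp add: matrix_matrix_mult_def)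
  qed
  ultimately have col: "A *v column i X = D $ i $ i *\<^sub>R column i X" for i
    by (simp add: vec_eq_iff column_def)
  have nz: "column i X \<noteq> 0" for i
    using orth by (metis norm_zero orthogonal_matrix_orthonormal_columns zero_neq_one)
  show ?thesis
    using nz by (auto simp: index_set_def eigenvector_of_def col simp flip: D_def)
qed

text \<open>The index sets partition the indices, so the definite description in \<open>class_of\<close> denotes the
  class that it should.\<close>

lemma class_of_eigvec_matrix:
  fixes A X :: "real^'n^'n"
  assumes "X \<in> eigvec_matrices A" "inj_on lam {1..m}" "lam ` {1..m} = eigenvalues A"
    and I: "\<forall>k\<in>{1..m}. index_set A (lam k) X = I k"
  shows "class_of m I i \<in> {1..m}" "i \<in> I (class_of m I i)"
    "lam (class_of m I i) = (transpose X ** A ** X) $ i $ i"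
proof -
  define \<mu> where "\<mu> = (transpose X ** A ** X) $ i $ i"
  have "i \<in> index_set A \<mu> X"
    by (simp add: index_set_eigvec_matrix[OF assms(1)] \<mu>_def)
  then have "\<mu> \<in> eigenvalues A" by (auto simp: index_set_def eigenvalues_def)
  then obtain k where k: "k \<in> {1..m}" "lam k = \<mu>" using assms(3) by force
  have mem: "i \<in> I l \<longleftrightarrow> lam l = \<mu>" if "l \<in> {1..m}" for l
  proof -
    have "I l = {i. (transpose X ** A ** X) $ i $ i = lam l}"
      unfolding bspec[OF I that, symmetric] by (rule index_set_eigvec_matrix[OF assms(1)])
    then have "i \<in> I l \<longleftrightarrow> \<mu> = lam l" by (simp add: \<mu>_def)
    then show ?thesis by (simp add: eq_commute)
  qed
  have "class_of m I i = k"
    unfolding class_of_def using k mem assms(2)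
    by (intro the_equality) (auto simp: inj_on_eq_iff[OF assms(2)])
  then show "class_of m I i \<in> {1..m}" "i \<in> I (class_of m I i)"
    "lam (class_of m I i) = (transpose X ** A ** X) $ i $ i"
    using k mem by (auto simp: \<mu>_def)
qed

lemma eig_gap_props:
  assumes "m \<ge> 2" "inj_on lam {1..m}"
  shows "eig_gap m lam > 0"
    and "\<lbrakk>k \<in> {1..m}; l \<in> {1..m}; k \<noteq> l\<rbrakk> \<Longrightarrow> eig_gap m lam \<le> \<bar>lam k - lam l\<bar>"
proof -
  define S where "S = {\<bar>lam k - lam l\<bar> | k l. k \<in> {1..m} \<and> l \<in> {1..m} \<and> k \<noteq> l}"
  have "S \<subseteq> (\<lambda>(k, l). \<bar>lam k - lam l\<bar>) ` ({1..m} \<times> {1..m})" by (auto simp: S_def)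
  then have fin: "finite S" by (rule finite_subset) auto
  have "\<bar>lam 1 - lam 2\<bar> \<in> S" using assms(1) by (force simp: S_def)
  moreover have "x > 0" if "x \<in> S" for x
    using that inj_on_eq_iff[OF assms(2)] by (auto simp: S_def)
  ultimately show "eig_gap m lam > 0"
    unfolding eig_gap_def S_def [symmetric] using fin by (subst Min_gr_iff) auto
  show "eig_gap m lam \<le> \<bar>lam k - lam l\<bar>" if "k \<in> {1..m}" "l \<in> {1..m}" "k \<noteq> l"
    unfolding eig_gap_def S_def [symmetric] using fin that by (intro Min_le) (auto simp: S_def)
qed

text \<open>Here \<open>Xt = X G\<close> with \<open>X\<close> orthogonal, so \<open>X\<close> cancels in \<open>Xt\<^sup>T Xt\<close> and turns \<open>A\<close> into \<open>D\<close> in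
  \<open>Xt\<^sup>T A Xt\<close>.\<close>

lemma correction_solves:
  fixes A Xt F :: "real^'n^'n"
  assumes "Xt ** (mat 1 + F) \<in> eigvec_matrices A" "spectral_norm F < 1"
  defines "D \<equiv> transpose (Xt ** (mat 1 + F)) ** A ** (Xt ** (mat 1 + F))"
  shows "eq_a Xt F i j" and "eq_b A Xt F (diag_vec D) i j"
proof -
  define X where "X = Xt ** (mat 1 + F)"
  define G where "G = matrix_inv (mat 1 + F)"
  have Xt: "Xt = X ** G"
    using inverse_one_plus(1)[OF assms(2)] by (simp add: X_def G_def flip: matrix_mul_assoc)
  have orth: "transpose X ** X = mat 1" and diag: "diag_mat (diag_vec D) = D"
    using assms(1)
    by (auto simp: eigvec_matrices_def orthogonal_matrix_def is_diagonal_def D_def X_def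
        diag_mat_def diag_vec_def vec_eq_iff)
  have "transpose Xt ** Xt = transpose G ** (transpose X ** X) ** G"
    by (simp add: Xt matrix_transpose_mul matrix_mul_assoc)
  then show "eq_a Xt F i j" by (simp add: eq_a_iff orth G_def)
  have "D = transpose X ** A ** X" by (simp add: D_def X_def)
  then have "mat_S A Xt = transpose G ** D ** G"
    by (simp add: mat_S_def Xt matrix_transpose_mul matrix_mul_assoc)
  then show "eq_b A Xt F (diag_vec D) i j" by (simp add: eq_b_iff diag G_def)
qed

text \<open>The bound \<open>p / 2\<close> on the solutions becomes the bound \<open>p\<close> on \<open>F - \<Delta>(F)\<close>.\<close>

lemma solves_P'_unique:
  fixes A Xt F F' :: "real^'n^'n"
  assumes "solves_P' A Xt K (F, c)" and "solves_P' A Xt K (F', d)"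
    and "\<And>i j. K i \<noteq> K j \<Longrightarrow> \<eta> \<le> \<bar>c $ i - c $ j\<bar>" and "\<eta> > 0"
    and "norm F \<le> p / 2" "norm F' \<le> p / 2" "p \<le> 1/6" "norm c \<le> L"
    and "contraction_const CARD('n) \<eta> L * p < 1"
  shows "(F', d) = (F, c)"
proof -
  note s = assms(1,2)[unfolded solves_P'_def, simplified]
  define P where "P = F' - Delta F'"
  define Q where "Q = F - Delta F"
  have G: "matrix_inv (mat 1 + F') = mat 1 - P" "matrix_inv (mat 1 + F) = mat 1 - Q"
    using minus_Delta[of F'] minus_Delta[of F] by (simp_all add: P_def Q_def)
  have h: "P - Q = (mat 1 - P) ** (F' - F) ** (mat 1 - Q)"
    unfolding P_def Q_def using s by (intro minus_Delta_diff) auto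
  have "norm P \<le> 2 * norm F'" "norm Q \<le> 2 * norm F"
    unfolding P_def Q_def using s assms(5-7) by (auto intro!: norm_minus_Delta_le)
  then have bounds: "norm P \<le> p" "norm Q \<le> p" using assms(5,6) by auto
  have a: "(transpose (mat 1 - P) ** (mat 1 - P)) $ i $ j
      = (transpose (mat 1 - Q) ** (mat 1 - Q)) $ i $ j" for i j
  proof -
    have "eq_a Xt F' i j" "eq_a Xt F i j" using s by auto
    then show ?thesis by (simp add: eq_a_iff G)
  qed
  have b: "(transpose (mat 1 - P) ** diag_mat d ** (mat 1 - P)) $ i $ j
      = (transpose (mat 1 - Q) ** diag_mat c ** (mat 1 - Q)) $ i $ j"
    if "K i \<noteq> K j \<or> i = j" for i j
  proof -
    have "eq_b A Xt F' d i j" "eq_b A Xt F c i j" using s that by auto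
    then show ?thesis by (simp add: eq_b_iff G)
  qed
  have sym: "(F' - F) $ i $ j = (F' - F) $ j $ i" if "K i = K j" for i j
    using s that by (simp add: vector_minus_component)
  have "F' - F = 0" "d = c"
    using linearized_uniqueness[OF h a b sym assms(3,4) bounds assms(7,8,9)] by blast+
  then show ?thesis by simp
qed

theorem theorem3p5:
  fixes A :: "real^'n^'n" and m :: nat and lam :: "nat \<Rightarrow> real"
  assumes "transpose A = A"
    and "m \<ge> 2"
    and "inj_on lam {1..m}"
    and "lam ` {1..m} = eigenvalues A"
  shows "\<exists>\<epsilon>>0. \<forall>Xt :: real^'n^'n. invertible Xt \<longrightarrow>
    (\<forall>E\<in>near_corrections A Xt. \<forall>I K Fs Ds zs \<delta>.
       I = (\<lambda>k. index_set A (lam k) (Xt ** (mat 1 + E))) \<longrightarrow>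
       K = class_of m I \<longrightarrow>
       is_F_star A m lam Xt I Fs \<longrightarrow>
       Ds = transpose (Xt ** (mat 1 + Fs)) ** A ** (Xt ** (mat 1 + Fs)) \<longrightarrow>
       zs = (Fs, diag_vec Ds) \<longrightarrow>
       spectral_norm Fs < \<epsilon> \<longrightarrow>
       0 < \<delta> \<longrightarrow> \<delta> < min (eig_gap m lam / 3) (spectral_norm Fs) \<longrightarrow>
       solves_P A Xt K zs \<and> {z \<in> ball zs \<delta>. solves_P' A Xt K z} = {zs})"
proof -
  \<comment> \<open>The choice of \<open>p\<close> yields both \<open>C p < 1\<close> and \<open>p \<le> 1/6\<close>. In the ball, \<open>\<parallel>F\<parallel>\<close> is at most
    \<open>n \<epsilon> + \<delta> \<le> 2 n \<epsilon>\<close>, which the choice of \<open>\<epsilon>\<close> makes equal to \<open>p / 2\<close>.\<close>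
  define n where "n = real CARD('n)"
  define \<eta> where "\<eta> = eig_gap m lam"
  define L where "L = n * (\<Sum>k\<in>{1..m}. \<bar>lam k\<bar>)"
  define C where "C = contraction_const CARD('n) \<eta> L"
  define p where "p = 1 / (C + 6)"
  define \<epsilon> where "\<epsilon> = p / (4 * n)"
  have n: "n \<ge> 1" by (simp add: n_def Suc_le_eq)
  have \<eta>: "\<eta> > 0" using eig_gap_props(1)[OF assms(2,3)] by (simp add: \<eta>_def)
  have "L \<ge> 0" unfolding L_def using n by (intro mult_nonneg_nonneg sum_nonneg) auto
  then have C: "C \<ge> 0" unfolding C_def contraction_const_def using \<eta> by simp
  then have p: "p > 0" "p \<le> 1/6" "C * p < 1" by (auto simp: p_def field_simps)
  have "\<epsilon> > 0" using p n by (simp add: \<epsilon>_def)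
  moreover have "solves_P A Xt K zs \<and> {z \<in> ball zs \<delta>. solves_P' A Xt K z} = {zs}"
    if K: "K = class_of m I" and Fs: "is_F_star A m lam Xt I Fs"
      and Ds: "Ds = transpose (Xt ** (mat 1 + Fs)) ** A ** (Xt ** (mat 1 + Fs))"
      and zs: "zs = (Fs, diag_vec Ds)" and small: "spectral_norm Fs < \<epsilon>"
      and \<delta>: "0 < \<delta>" "\<delta> < min (eig_gap m lam / 3) (spectral_norm Fs)"
    for Xt Fs Ds :: "real^'n^'n" and I K zs \<delta>
  proof -
    define X where "X = Xt ** (mat 1 + Fs)"
    have X: "X \<in> eigvec_matrices A"
      and I: "\<forall>k\<in>{1..m}. index_set A (lam k) X = I k"
      and sym: "\<And>k i j. k \<in> {1..m} \<Longrightarrow> i \<in> I k \<Longrightarrow> j \<in> I k \<Longrightarrow> Fs $ i $ j = Fs $ j $ i"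
      and lt1: "spectral_norm Fs < 1"
      using Fs by (auto simp: is_F_star_def corrections_def X_def)
    note cls = class_of_eigvec_matrix[OF X assms(3,4) I, folded K]
    have diag: "diag_vec Ds $ i = lam (K i)" for i
      unfolding cls(3) by (simp add: diag_vec_def Ds X_def)
    have P: "solves_P A Xt K zs"
      unfolding solves_P_def zs Ds
      using correction_solves[OF X[unfolded X_def] lt1] lt1 sym cls(1,2) by (auto, metis)
    then have P': "solves_P' A Xt K zs" by (auto simp: solves_P_def solves_P'_def)
    have "z = zs" if z: "z \<in> ball zs \<delta>" "solves_P' A Xt K z" for z
    proof -
      obtain F d where Fd: "z = (F, d)" by (cases z)
      have Fs_le: "norm Fs \<le> n * \<epsilon>"
        using norm_le_card_spectral_norm[of Fs]
      proof (rule order_trans)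
        show "real CARD('n) * spectral_norm Fs \<le> n * \<epsilon>"
          unfolding n_def using small by (intro mult_left_mono) auto
      qed
      have "norm (F - Fs) \<le> dist z zs"
        using norm_fst_le[of "F - Fs" "d - diag_vec Ds"] by (simp add: Fd zs dist_norm)
      also have "\<dots> < \<epsilon>"
        using z \<delta> small by (simp add: dist_commute)
      finally have "norm F \<le> n * \<epsilon> + \<epsilon>"
        using Fs_le norm_triangle_ineq[of "F - Fs" Fs] by simp
      also have "\<dots> \<le> 2 * n * \<epsilon>"
        using n \<open>\<epsilon> > 0\<close> by simp
      finally have F: "norm F \<le> p / 2" using n by (simp add: \<epsilon>_def)
      have Fs2: "norm Fs \<le> p / 2" using Fs_le n p by (simp add: \<epsilon>_def)
      have "norm (diag_vec Ds) \<le> (\<Sum>i\<in>(UNIV::'n set). \<bar>lam (K i)\<bar>)"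
        using norm_le_l1_cart[of "diag_vec Ds"] by (simp add: diag)
      also have "\<dots> \<le> (\<Sum>i\<in>(UNIV::'n set). \<Sum>k\<in>{1..m}. \<bar>lam k\<bar>)"
        using cls(1) by (intro sum_mono member_le_sum) auto
      finally have L: "norm (diag_vec Ds) \<le> L" by (simp add: L_def n_def)
      have gap: "\<eta> \<le> \<bar>diag_vec Ds $ i - diag_vec Ds $ j\<bar>" if "K i \<noteq> K j" for i j
        unfolding diag \<eta>_def by (intro eig_gap_props assms cls(1) that)
      show ?thesis
        unfolding Fd zs
        using P' z(2) gap \<eta> Fs2 F p(2) L p(3) unfolding Fd zs C_def
        by (intro solves_P'_unique) auto
    qed
    then show ?thesis using P P' \<delta> by auto
  qed
  ultimately show ?thesis by blast
qed

end
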